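(* Let $\rho\in(0,1)$ be the unique positive real root of $1-x-x^3=0$, and let $\alpha=\rho^{-1}$. Then $$A_n \sim C\,\alpha^{n}\quad (n\to\infty),\qquad C=\frac{2\rho-1}{(1-\rho)^2(1+3\rho^2)},$$ i.e. $\lim_{n\to\infty}A_n/(C\alpha^n)=1$. Moreover, $\alpha$ is the unique real root greater than $1$ of $\alpha^3=\alpha^2+1$.
   Context: $S_n$ is the set of permutations of $\{1,\dots,n\}$ written in one-line notation. A permutation $\pi\in S_n$ avoids $132$ if there are no indices $i<j<k$ with $\pi_i<\pi_k<\pi_j$. For $n\ge 1$, $A_n$ denotes the number of $\pi\in S_n$ that avoid $132$ and satisfy $|\pi_{i+1}-\pi_i|\le 2$ for all $1\le i<n$. *)

theory Defs
  imports "HOL-Library.Landau_Symbols" "HOL-Combinatorics.Permutations" Complex_Main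
begin

text \<open>A permutation of \<open>{1..n}\<close> is a function \<open>p\<close> with \<open>p permutes {1..n}\<close>;
  its one-line notation is \<open>p 1, \<dots>, p n\<close>.\<close>

definition avoids_132 :: "nat \<Rightarrow> (nat \<Rightarrow> nat) \<Rightarrow> bool" where
  "avoids_132 n p \<longleftrightarrow>
     \<not> (\<exists>i\<in>{1..n}. \<exists>j\<in>{1..n}. \<exists>k\<in>{1..n}. i < j \<and> j < k \<and> p i < p k \<and> p k < p j)"

definition num_A :: "nat \<Rightarrow> nat" where
  "num_A n = card {p. p permutes {1..n} \<and> avoids_132 n p \<and>
                  (\<forall>i. 1 \<le> i \<and> i < n \<longrightarrow> \<bar>int (p (i + 1)) - int (p i)\<bar> \<le> 2)}"

text \<open>Existence and uniqueness of the root are not assumed here; they are claimed by the theorem.\<close>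

definition rho :: real where
  "rho = (THE x. 0 < x \<and> 1 - x - x ^ 3 = 0)"

definition alpha :: real where
  "alpha = inverse rho"

definition const_C :: real where
  "const_C = (2 * rho - 1) / ((1 - rho)\<^sup>2 * (1 + 3 * rho\<^sup>2))"

end

theory Submission
  imports Defs
begin

text \<open>In a 132-avoiding permutation every entry left of the maximum \<open>n\<close> exceeds every entry right of
  it. If both sides are nonempty, the two neighbours of \<open>n\<close> differ from it by at most 2, so they
  must be \<open>n - 1\<close> on the left and \<open>n - 2\<close> on the right, and the permutation begins with
  \<open>n - 1, n, n - 2\<close>. Hence deleting \<open>n\<close> (or \<open>n - 1, n\<close>) leaves a permutation of the same kind whose
  first or last entry is prescribed. For the number \<open>s\<^sub>n\<close> of those starting with \<open>n\<close> this gives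
  \<open>s\<^sub>n = s\<^sub>n\<^sub>-\<^sub>1 + s\<^sub>n\<^sub>-\<^sub>3 + 1\<close> for \<open>n \<ge> 4\<close>, and
  \<open>A\<^sub>n = s\<^sub>n + s\<^sub>n\<^sub>-\<^sub>2 + n - 1\<close> for \<open>n \<ge> 3\<close>. So \<open>s\<^sub>n + 1\<close> satisfies Narayana's
  recurrence, whose characteristic polynomial has \<open>\<alpha>\<close> as its dominant root.\<close>

section \<open>Pattern avoidance for lists in one-line notation\<close>

text \<open>The head is tested as the smallest entry of a pattern against all later pairs, so that
  prepending an entry unfolds by simplification.\<close>

fun list_avoids_132 :: "nat list \<Rightarrow> bool" where
  "list_avoids_132 [] \<longleftrightarrow> True"
| "list_avoids_132 (x # xs) \<longleftrightarrow>
     list_avoids_132 xs \<and> sorted_wrt (\<lambda>y z. \<not> (x < z \<and> z < y)) xs"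

lemma list_avoids_132_iff_nth:
  "list_avoids_132 xs \<longleftrightarrow>
     (\<forall>i j k. i < j \<and> j < k \<and> k < length xs \<longrightarrow> \<not> (xs ! i < xs ! k \<and> xs ! k < xs ! j))"
proof (induction xs)
  case (Cons x xs)
  show ?case (is "?l \<longleftrightarrow> ?r")
  proof
    assume l: ?l
    show ?r
    proof (intro allI impI)
      fix i j k assume ijk: "i < j \<and> j < k \<and> k < length (x # xs)"
      then obtain j' k' where jk: "j = Suc j'" "k = Suc k'"
        by (metis less_nat_zero_code not0_implies_Suc)
      show "\<not> ((x # xs) ! i < (x # xs) ! k \<and> (x # xs) ! k < (x # xs) ! j)"
        using l ijk jk Cons.IH by (cases i) (auto simp: sorted_wrt_iff_nth_less)
    qed
  next
    assume r: ?r
    have "list_avoids_132 xs"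
      unfolding Cons.IH
    proof (intro allI impI)
      fix i j k assume "i < j \<and> j < k \<and> k < length xs"
      then show "\<not> (xs ! i < xs ! k \<and> xs ! k < xs ! j)"
        using r[rule_format, of "Suc i" "Suc j" "Suc k"] by auto
    qed
    moreover have "sorted_wrt (\<lambda>y z. \<not> (x < z \<and> z < y)) xs"
      unfolding sorted_wrt_iff_nth_less
    proof (intro allI impI)
      fix j k assume "j < k" "k < length xs"
      then show "\<not> (x < xs ! k \<and> xs ! k < xs ! j)"
        using r[rule_format, of 0 "Suc j" "Suc k"] by auto
    qed
    ultimately show ?l by simp
  qed
qed simp

text \<open>A pattern lies in one of the two blocks or is cut after its first or its second entry,
  which gives the four conjuncts.\<close>

lemma list_avoids_132_append:
  "list_avoids_132 (xs @ ys) \<longleftrightarrow> list_avoids_132 xs \<and> list_avoids_132 ys \<and>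
     (\<forall>x\<in>set xs. sorted_wrt (\<lambda>y z. \<not> (x < z \<and> z < y)) ys) \<and>
     (\<forall>z\<in>set ys. sorted_wrt (\<lambda>x y. \<not> (x < z \<and> z < y)) xs)"
  by (induction xs) (auto simp: sorted_wrt_append)

definition close :: "nat \<Rightarrow> nat \<Rightarrow> bool" where
  "close x y \<longleftrightarrow> \<bar>int y - int x\<bar> \<le> 2"

definition good :: "nat \<Rightarrow> nat list \<Rightarrow> bool" where
  "good n xs \<longleftrightarrow> distinct xs \<and> set xs = {1..n} \<and> list_avoids_132 xs \<and> successively close xs"

lemma good_length: "good n xs \<Longrightarrow> length xs = n"
  by (metis good_def card_atLeastAtMost diff_Suc_1 distinct_card)

text \<open>Reading off one-line notation is a bijection, which moves the count from functions to
  lists, where entries can be deleted.\<close>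

lemma num_A_eq_card_good: "num_A n = card {xs. good n xs}"
proof -
  let ?f = "\<lambda>p. map p [1..<Suc n]"
  \<comment> \<open>The inverse is the identity off \<open>{1..n}\<close>, as
    \<open>permutes\<close> demands; \<open>i - 1\<close> converts positions counted from 1 to list
    indices.\<close>
  let ?g = "\<lambda>xs i. if i \<in> {1..n} then xs ! (i - 1) else (i::nat)"
  let ?P = "{p. p permutes {1..n} \<and> avoids_132 n p \<and>
                  (\<forall>i. 1 \<le> i \<and> i < n \<longrightarrow> \<bar>int (p (i + 1)) - int (p i)\<bar> \<le> 2)}"
  have av: "list_avoids_132 (?f p) \<longleftrightarrow> avoids_132 n p" for p
  proof
    assume l: "list_avoids_132 (?f p)"
    show "avoids_132 n p"
      unfolding avoids_132_def
    proof clarify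
      fix i j k assume "i \<in> {1..n}" "j \<in> {1..n}" "k \<in> {1..n}" "i < j" "j < k"
        "p i < p k" "p k < p j"
      moreover from this have "i - 1 < j - 1 \<and> j - 1 < k - 1 \<and> k - 1 < length (?f p)" by auto
      ultimately show False
        using l[unfolded list_avoids_132_iff_nth, rule_format, of "i - 1" "j - 1" "k - 1"]
        by (auto simp del: upt_Suc)
    qed
  next
    assume r: "avoids_132 n p"
    show "list_avoids_132 (?f p)"
      unfolding list_avoids_132_iff_nth
    proof (intro allI impI notI)
      fix i j k assume "i < j \<and> j < k \<and> k < length (?f p)"
        "?f p ! i < ?f p ! k \<and> ?f p ! k < ?f p ! j"
      then have "Suc i \<in> {1..n}" "Suc j \<in> {1..n}" "Suc k \<in> {1..n}" "Suc i < Suc j" "Suc j < Suc k"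
        "p (Suc i) < p (Suc k)" "p (Suc k) < p (Suc j)"
        by (auto simp del: upt_Suc)
      then show False using r unfolding avoids_132_def by blast
    qed
  qed
  have cl: "successively close (?f p) \<longleftrightarrow>
      (\<forall>i. 1 \<le> i \<and> i < n \<longrightarrow> \<bar>int (p (i + 1)) - int (p i)\<bar> \<le> 2)" for p
  proof -
    have "successively close (?f p) \<longleftrightarrow> (\<forall>i. Suc i < n \<longrightarrow> close (p (Suc i)) (p (Suc (Suc i))))"
      unfolding successively_conv_nth by (auto simp del: upt_Suc)
    also have "\<dots> \<longleftrightarrow> (\<forall>i. 1 \<le> i \<and> i < n \<longrightarrow> close (p i) (p (i + 1)))"
      by (auto simp: Suc_le_eq gr0_conv_Suc)
    finally show ?thesis by (simp add: close_def)
  qed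
  have "bij_betw ?f ?P {xs. good n xs}"
  proof (rule bij_betw_byWitness[where f' = ?g])
    show "\<forall>p\<in>?P. ?g (?f p) = p"
    proof clarify
      fix p assume "p permutes {1..n}"
      then show "?g (?f p) = p"
        by (auto simp: fun_eq_iff permutes_def simp del: upt_Suc)
    qed
    show fg: "\<forall>xs\<in>{xs. good n xs}. ?f (?g xs) = xs"
      by (auto intro!: nth_equalityI dest: good_length simp del: upt_Suc)
    show "?f ` ?P \<subseteq> {xs. good n xs}"
    proof clarify
      fix p assume p: "p permutes {1..n}" "avoids_132 n p"
        "\<forall>i. 1 \<le> i \<and> i < n \<longrightarrow> \<bar>int (p (i + 1)) - int (p i)\<bar> \<le> 2"
      have "set [1..<Suc n] = {1..n}" by auto
      then have "set (?f p) = {1..n}" "distinct (?f p)"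
        using permutes_image[OF p(1)] permutes_inj_on[OF p(1)]
        by (simp_all add: distinct_map del: upt_Suc)
      then show "good n (?f p)" using p av[of p] cl[of p] by (simp add: good_def del: upt_Suc)
    qed
    show "?g ` {xs. good n xs} \<subseteq> ?P"
    proof clarify
      fix xs assume g: "good n xs"
      then have f: "?f (?g xs) = xs" using fg by blast
      have len: "length xs = n" using g by (rule good_length)
      have "bij_betw (?g xs) {1..n} {1..n}"
        unfolding bij_betw_def
      proof
        have "distinct (?f (?g xs))" "set (?f (?g xs)) = {1..n}"
          using g f unfolding good_def by simp_all
        moreover have "set [1..<Suc n] = {1..n}" by auto
        ultimately show "inj_on (?g xs) {1..n}" "?g xs ` {1..n} = {1..n}"
          by (simp_all only: distinct_map set_map)
      qed
      then have "?g xs permutes {1..n}"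
        by (rule bij_imp_permutes) auto
      moreover have "avoids_132 n (?g xs)"
        using g av[of "?g xs"] f unfolding good_def by simp
      moreover have "\<forall>i. 1 \<le> i \<and> i < n \<longrightarrow> \<bar>int (?g xs (i + 1)) - int (?g xs i)\<bar> \<le> 2"
        using g cl[of "?g xs"] f unfolding good_def by simp
      ultimately show "?g xs permutes {1..n} \<and> avoids_132 n (?g xs) \<and>
         (\<forall>i. 1 \<le> i \<and> i < n \<longrightarrow> \<bar>int (?g xs (i + 1)) - int (?g xs i)\<bar> \<le> 2)"
        by blast
    qed
  qed
  then show ?thesis unfolding num_A_def by (rule bij_betw_same_card)
qed

lemma sorted_wrt_if_all:
  "(\<And>y z. y \<in> set xs \<Longrightarrow> z \<in> set xs \<Longrightarrow> P y z) \<Longrightarrow> sorted_wrt P xs"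
  by (auto simp: sorted_wrt_iff_nth_less)

section \<open>Removing the maximum\<close>

text \<open>A leading maximum could only be the smallest entry of a pattern, which is impossible.
  Only the step to the next entry is left to check, and its upper bound is automatic.\<close>

lemma good_Cons_max:
  "good (Suc n) (Suc n # xs) \<longleftrightarrow> good n xs \<and> (xs = [] \<or> n \<le> hd xs + 1)"
proof -
  have "distinct (Suc n # xs) \<and> set (Suc n # xs) = {1..Suc n} \<longleftrightarrow> distinct xs \<and> set xs = {1..n}"
    by (auto simp: atLeastAtMostSuc_conv insert_ident insert_commute[of "Suc n"])
  moreover have "list_avoids_132 (Suc n # xs) \<longleftrightarrow> list_avoids_132 xs" if "set xs = {1..n}"
  proof -
    have "sorted_wrt (\<lambda>y z. \<not> (Suc n < z \<and> z < y)) xs"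
      using that by (intro sorted_wrt_if_all) auto
    then show ?thesis by simp
  qed
  moreover have "successively close (Suc n # xs) \<longleftrightarrow>
      successively close xs \<and> (xs = [] \<or> n \<le> hd xs + 1)" if "set xs = {1..n}"
  proof -
    have "hd xs \<le> n" if "xs \<noteq> []" using hd_in_set[OF that] \<open>set xs = {1..n}\<close> by simp
    then show ?thesis by (auto simp: successively_Cons close_def)
  qed
  ultimately show ?thesis unfolding good_def by blast
qed

text \<open>A final maximum could only be the middle value of a pattern, which is
  impossible.\<close>

lemma good_snoc_max:
  "good (Suc n) (xs @ [Suc n]) \<longleftrightarrow> good n xs \<and> (xs = [] \<or> n \<le> last xs + 1)"
proof -
  have "distinct (xs @ [Suc n]) \<and> set (xs @ [Suc n]) = {1..Suc n} \<longleftrightarrow> distinct xs \<and> set xs = {1..n}"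
    by (auto simp: atLeastAtMostSuc_conv insert_ident insert_commute[of "Suc n"])
  moreover have "list_avoids_132 (xs @ [Suc n]) \<longleftrightarrow> list_avoids_132 xs" if "set xs = {1..n}"
  proof -
    have "sorted_wrt (\<lambda>x y. \<not> (x < Suc n \<and> Suc n < y)) xs"
      using that by (intro sorted_wrt_if_all) auto
    then show ?thesis by (simp add: list_avoids_132_append)
  qed
  moreover have "successively close (xs @ [Suc n]) \<longleftrightarrow>
      successively close xs \<and> (xs = [] \<or> n \<le> last xs + 1)" if "set xs = {1..n}"
  proof -
    have "last xs \<le> n" if "xs \<noteq> []" using last_in_set[OF that] \<open>set xs = {1..n}\<close> by simp
    then show ?thesis by (cases "xs = []") (auto simp: successively_append_iff close_def)
  qed
  ultimately show ?thesis unfolding good_def by blast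
qed

text \<open>No entry of \<open>xs\<close> exceeds the two in front, so these create no pattern; the
  step down from \<open>n + 2\<close> to a value at most \<open>n\<close> forces that value to be
  \<open>n\<close>.\<close>

lemma good_Cons_second_max:
  assumes "xs \<noteq> []"
  shows "good (Suc (Suc n)) (Suc n # Suc (Suc n) # xs) \<longleftrightarrow> good n xs \<and> hd xs = n"
proof -
  have "distinct (Suc n # Suc (Suc n) # xs) \<and> set (Suc n # Suc (Suc n) # xs) = {1..Suc (Suc n)}
      \<longleftrightarrow> distinct xs \<and> set xs = {1..n}"
    by (auto simp: atLeastAtMostSuc_conv insert_ident insert_commute[of "Suc n"])
  moreover have "list_avoids_132 (Suc n # Suc (Suc n) # xs) \<longleftrightarrow> list_avoids_132 xs"
    if "set xs = {1..n}"
  proof -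
    have "\<And>z. z \<in> set xs \<Longrightarrow> z \<le> n" using that by auto
    moreover have "sorted_wrt (\<lambda>y z. \<not> (m < z \<and> z < y)) xs" if "n < m" for m
      using \<open>set xs = {1..n}\<close> that
      by (intro sorted_wrt_if_all) auto
    ultimately show ?thesis by fastforce
  qed
  moreover have "successively close (Suc n # Suc (Suc n) # xs) \<longleftrightarrow> successively close xs \<and> hd xs = n"
    if "set xs = {1..n}"
  proof -
    have "hd xs \<le> n" using hd_in_set[OF assms] \<open>set xs = {1..n}\<close> by simp
    then show ?thesis using assms by (auto simp: successively_Cons close_def)
  qed
  ultimately show ?thesis unfolding good_def by blast
qed

lemma good_cases:
  assumes "good (Suc n) xs"
  obtains (first) R where "xs = Suc n # R"
    | (last) L where "xs = L @ [Suc n]"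
    | (inner) R where "xs = n # Suc n # R" "R \<noteq> []"
proof -
  have set: "set xs = {1..Suc n}" and dist: "distinct xs" and av: "list_avoids_132 xs"
    and cl: "successively close xs"
    using assms by (auto simp: good_def)
  have "Suc n \<in> set xs" using set by simp
  then obtain L R where LR: "xs = L @ Suc n # R" by (meson split_list)
  show thesis
  proof (cases "L = [] \<or> R = []")
    case True
    then show ?thesis using LR first last by auto
  next
    case False
    \<comment> \<open>Otherwise \<open>x\<close>, the maximum and \<open>z\<close> would form a 132
      pattern.\<close>
    have *: "z < x" if "x \<in> set L" "z \<in> set R" for x z
    proof -
      have "z \<in> {1..Suc n}" using set LR that by auto
      moreover have "z \<noteq> Suc n" "x \<noteq> z" using dist LR that by auto
      moreover have "\<not> (x < z \<and> z < Suc n)"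
        using av LR that by (auto simp: list_avoids_132_append)
      ultimately show ?thesis by auto
    qed
    have "close (last L) (Suc n)" "close (Suc n) (hd R)"
      using cl LR False by (auto simp: successively_append_iff successively_Cons)
    moreover have le: "x \<le> n" if "x \<in> set L" for x
    proof -
      have "x \<in> {1..Suc n}" using set LR that by auto
      moreover have "x \<noteq> Suc n" using dist LR that by auto
      ultimately show ?thesis by auto
    qed
    moreover have lt: "hd R < x" if "x \<in> set L" for x using * that False by auto
    moreover have "last L \<in> set L" using False by simp
    \<comment> \<open>Closeness to \<open>n + 1\<close> gives \<open>hd R >= n - 1\<close>, while
      \<open>hd R < last L <= n\<close>.\<close>
    ultimately have "n = hd R + 1" by (fastforce simp: close_def)
    \<comment> \<open>Entries of \<open>L\<close> lie strictly above \<open>hd R = n - 1\<close> and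
      are at most \<open>n\<close>.\<close>
    then have "set L \<subseteq> {n}" using le lt by fastforce
    moreover have "distinct L" using dist LR by simp
    ultimately have "L = [n]"
      using False by (cases L; cases "tl L") auto
    then show ?thesis using inner[of R] LR False by simp
  qed
qed

lemma finite_good: "finite {xs. good n xs}"
  by (rule finite_subset[OF _ finite_lists_length_eq[of "{1..n}" n]])
     (clarsimp simp: good_length, auto simp: good_def)

lemma good_hd_le: "good n xs \<Longrightarrow> xs \<noteq> [] \<Longrightarrow> hd xs \<le> n"
  and good_last_le: "good n xs \<Longrightarrow> xs \<noteq> [] \<Longrightarrow> last xs \<le> n"
  using hd_in_set[of xs] last_in_set[of xs] by (auto simp: good_def)

lemma good_not_Nil: "good (Suc n) xs \<Longrightarrow> xs \<noteq> []"
  by (auto dest: good_length)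

text \<open>Only the two largest remaining values are within 2 of the maximum. Requiring
  \<open>R\<close> to be nonempty keeps \<open>[1, 2]\<close> out of the third case, as the second
  already covers it.\<close>

lemma good_Suc_Suc:
  "good (Suc (Suc n)) xs \<longleftrightarrow>
     (\<exists>R. xs = Suc (Suc n) # R \<and> good (Suc n) R \<and> (hd R = Suc n \<or> hd R = n)) \<or>
     (\<exists>L. xs = L @ [Suc (Suc n)] \<and> good (Suc n) L \<and> (last L = Suc n \<or> last L = n)) \<or>
     (\<exists>R. xs = Suc n # Suc (Suc n) # R \<and> R \<noteq> [] \<and> good n R \<and> hd R = n)" (is "?l \<longleftrightarrow> ?r")
proof
  assume l: ?l
  then show ?r
  proof (cases rule: good_cases)
    case (first R)
    then have "good (Suc n) R" "Suc n \<le> hd R + 1"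
      using l good_Cons_max[of "Suc n" R] good_not_Nil[of n R] by auto
    moreover from this have "hd R \<le> Suc n" by (intro good_hd_le good_not_Nil)
    ultimately show ?thesis using first by force
  next
    case (last L)
    then have "good (Suc n) L" "Suc n \<le> List.last L + 1"
      using l good_snoc_max[of "Suc n" L] good_not_Nil[of n L] by auto
    moreover from this have "List.last L \<le> Suc n" by (intro good_last_le good_not_Nil)
    ultimately show ?thesis using last by force
  next
    case (inner R)
    then show ?thesis using l good_Cons_second_max[of R n] by blast
  qed
next
  assume ?r
  then show ?l
    using good_Cons_max[of "Suc n"] good_snoc_max[of "Suc n"] good_Cons_second_max[of _ n]
    by fastforce
qed

lemma good_0_iff: "good 0 xs \<longleftrightarrow> xs = []"
  by (auto simp: good_def)

lemma good_1_iff: "good (Suc 0) xs \<longleftrightarrow> xs = [Suc 0]"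
proof
  assume "good (Suc 0) xs"
  then have "length xs = 1" "set xs = {1}" by (auto simp: good_length) (auto simp: good_def)
  then show "xs = [Suc 0]" by (cases xs) auto
qed (auto simp: good_def)

lemma good_2_iff: "good (Suc (Suc 0)) xs \<longleftrightarrow> xs = [1, 2] \<or> xs = [2, 1]"
  unfolding good_Suc_Suc by (auto simp: good_1_iff good_0_iff)

lemma good_Suc_hd_neq: "good (Suc n) xs \<Longrightarrow> Suc n < a \<Longrightarrow> hd xs \<noteq> a"
  and good_Suc_last_neq: "good (Suc n) xs \<Longrightarrow> Suc n < a \<Longrightarrow> last xs \<noteq> a"
  using good_hd_le[of "Suc n" xs] good_last_le[of "Suc n" xs] good_not_Nil[of n xs] by auto

lemma not_good_if_less: "n < a \<Longrightarrow> \<not> good n (xs @ a # ys)"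
proof
  assume "n < a" "good n (xs @ a # ys)"
  moreover have "a \<in> set (xs @ a # ys)" by simp
  ultimately show False by (simp only: good_def) simp
qed

lemma good_hd_neq_last:
  assumes "good (Suc (Suc n)) xs"
  shows "hd xs \<noteq> last xs"
proof
  assume eq: "hd xs = last xs"
  obtain a ys where xs: "xs = a # ys" "ys \<noteq> []"
    using good_length[OF assms] by (cases xs; cases "tl xs") auto
  then have "last ys = a" "last ys \<in> set ys" using eq by auto
  then show False using assms xs by (auto simp: good_def)
qed

section \<open>Counting by first and last entry\<close>

definition starts :: "nat \<Rightarrow> nat \<Rightarrow> nat list set" where
  "starts n a = {xs. good n xs \<and> hd xs = a}"

definition ends :: "nat \<Rightarrow> nat \<Rightarrow> nat list set" where
  "ends n b = {xs. good n xs \<and> last xs = b}"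

lemma finite_starts [simp]: "finite (starts n a)"
  and finite_ends [simp]: "finite (ends n b)"
  unfolding starts_def ends_def by (auto intro: finite_subset[OF _ finite_good])

lemma starts_max:
  "starts (Suc (Suc n)) (Suc (Suc n)) =
     (#) (Suc (Suc n)) ` (starts (Suc n) (Suc n) \<union> starts (Suc n) n)"
  by (auto simp: starts_def good_Suc_Suc[of n] image_iff
      good_not_Nil good_Suc_hd_neq)

lemma ends_max:
  "ends (Suc (Suc n)) (Suc (Suc n)) =
     (\<lambda>L. L @ [Suc (Suc n)]) ` (ends (Suc n) (Suc n) \<union> ends (Suc n) n)"
  by (auto simp: ends_def good_Suc_Suc[of n] image_iff
      good_not_Nil good_Suc_last_neq
      dest: good_last_le)

text \<open>Deleting the leading maximum leaves a list ending in its own maximum, whose head must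
  then be the second largest value. So the roles of the two ends are swapped.\<close>

lemma starts_ends_max_second:
  "starts (Suc (Suc (Suc n))) (Suc (Suc (Suc n))) \<inter> ends (Suc (Suc (Suc n))) (Suc (Suc n)) =
     (#) (Suc (Suc (Suc n))) `
       (starts (Suc (Suc n)) (Suc n) \<inter> ends (Suc (Suc n)) (Suc (Suc n)))"
  by (auto simp: starts_def ends_def good_Suc_Suc[of "Suc n"] image_iff
      good_not_Nil good_Suc_hd_neq good_Suc_last_neq
      dest: good_hd_neq_last)

lemma starts_ends_second_max:
  "starts (Suc (Suc (Suc n))) (Suc (Suc n)) \<inter> ends (Suc (Suc (Suc n))) (Suc (Suc (Suc n))) =
     (\<lambda>L. L @ [Suc (Suc (Suc n))]) `
       (starts (Suc (Suc n)) (Suc (Suc n)) \<inter> ends (Suc (Suc n)) (Suc n))"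
  by (auto simp: starts_def ends_def good_Suc_Suc[of "Suc n"] image_iff Cons_eq_append_conv
      good_not_Nil not_good_if_less good_Suc_hd_neq good_Suc_last_neq
      dest: good_hd_neq_last)

text \<open>The maximum comes second or last. If it is last, the rest begins with its own maximum,
  so it can only end in its second largest value.\<close>

lemma starts_second:
  "starts (Suc (Suc (Suc n))) (Suc (Suc n)) =
     (\<lambda>R. Suc (Suc n) # Suc (Suc (Suc n)) # R) ` starts (Suc n) (Suc n) \<union>
     (\<lambda>L. L @ [Suc (Suc (Suc n))]) `
       (starts (Suc (Suc n)) (Suc (Suc n)) \<inter> ends (Suc (Suc n)) (Suc n))"
  by (auto simp: starts_def ends_def good_Suc_Suc[of "Suc n"] image_iff
      good_not_Nil good_Suc_hd_neq good_Suc_last_neq)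
     (metis good_hd_neq_last)

text \<open>The maximum must come first here: it is not last, and in the inner case the second
  largest value is at the front.\<close>

lemma ends_second:
  "ends (Suc (Suc (Suc n))) (Suc (Suc n)) =
     (#) (Suc (Suc (Suc n))) `
       (starts (Suc (Suc n)) (Suc n) \<inter> ends (Suc (Suc n)) (Suc (Suc n)))"
  by (auto simp: starts_def ends_def good_Suc_Suc[of "Suc n"] image_iff
      good_not_Nil good_Suc_hd_neq good_Suc_last_neq)
     (metis good_hd_neq_last)

text \<open>From size three on, the inner case has a nonempty tail automatically, so no side
  condition remains.\<close>

lemma good_Suc_Suc_Suc_eq:
  "{xs. good (Suc (Suc (Suc n))) xs} =
     starts (Suc (Suc (Suc n))) (Suc (Suc (Suc n))) \<union>
     (\<lambda>R. Suc (Suc n) # Suc (Suc (Suc n)) # R) ` starts (Suc n) (Suc n) \<union>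
     ends (Suc (Suc (Suc n))) (Suc (Suc (Suc n)))"
  by (auto simp: starts_def ends_def good_Suc_Suc[of "Suc n"] image_iff
      good_not_Nil good_Suc_hd_neq good_Suc_last_neq
      dest: good_hd_neq_last)

text \<open>Each set is an image of the other one at the previous size, hence the joint induction.
  The unique members run down one parity class and up the other, such as 5 3 1 2 4 and its
  reversal-like partner 4 2 1 3 5.\<close>

lemma card_zigzag:
  "card (starts (Suc (Suc n)) (Suc (Suc n)) \<inter> ends (Suc (Suc n)) (Suc n)) = 1 \<and>
   card (starts (Suc (Suc n)) (Suc n) \<inter> ends (Suc (Suc n)) (Suc (Suc n))) = 1"
proof (induction n)
  case 0
  have "starts (Suc (Suc 0)) (Suc (Suc 0)) \<inter> ends (Suc (Suc 0)) (Suc 0) = {[2, 1]}"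
    "starts (Suc (Suc 0)) (Suc 0) \<inter> ends (Suc (Suc 0)) (Suc (Suc 0)) = {[1, 2]}"
    by (auto simp: starts_def ends_def good_2_iff)
  then show ?case by simp
next
  case (Suc n)
  then show ?case
    unfolding starts_ends_max_second starts_ends_second_max
    by (simp add: card_image inj_on_def)
qed

text \<open>By \<open>ends_max\<close>, each size adds the lists ending in the second largest value,
  and there is exactly one. Size two is done by hand since \<open>ends_second\<close> begins at size
  three.\<close>

lemma card_ends_max: "card (ends (Suc (Suc n)) (Suc (Suc n))) = n + 1"
proof (induction n)
  case 0
  have "ends (Suc (Suc 0)) (Suc (Suc 0)) = {[1, 2]}"
    by (auto simp: ends_def good_2_iff)
  then show ?case by simp
next
  case (Suc n)
  have "card (ends (Suc (Suc n)) (Suc n)) = 1"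
  proof (cases n)
    case 0
    have "ends (Suc (Suc 0)) (Suc 0) = {[2, 1]}"
      by (auto simp: ends_def good_2_iff)
    then show ?thesis using 0 by simp
  next
    case (Suc k)
    then show ?thesis using card_zigzag[of k] by (simp add: ends_second card_image)
  qed
  moreover have "ends (Suc (Suc n)) (Suc (Suc n)) \<inter> ends (Suc (Suc n)) (Suc n) = {}"
    by (auto simp: ends_def)
  ultimately show ?case
    using Suc.IH by (simp add: ends_max[of "Suc n"] card_image inj_on_def card_Un_disjoint)
qed

lemma card_starts_max_Suc:
  "card (starts (Suc (Suc n)) (Suc (Suc n))) =
     card (starts (Suc n) (Suc n)) + card (starts (Suc n) n)"
proof -
  have "starts (Suc n) (Suc n) \<inter> starts (Suc n) n = {}"
    by (auto simp: starts_def)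
  then show ?thesis by (simp add: starts_max card_image card_Un_disjoint)
qed

lemma card_starts_second:
  "card (starts (Suc (Suc (Suc n))) (Suc (Suc n))) = card (starts (Suc n) (Suc n)) + 1"
proof -
  \<comment> \<open>The last entry separates the two images: in the first it belongs to
    \<open>R\<close>, hence is at most \<open>n + 1\<close>.\<close>
  have "(\<lambda>R. Suc (Suc n) # Suc (Suc (Suc n)) # R) ` starts (Suc n) (Suc n) \<inter>
     (\<lambda>L. L @ [Suc (Suc (Suc n))]) `
       (starts (Suc (Suc n)) (Suc (Suc n)) \<inter> ends (Suc (Suc n)) (Suc n)) = {}"
    using good_last_le[of "Suc n"] good_not_Nil[of n]
    by (fastforce simp: starts_def dest: arg_cong[where f = last])
  then show ?thesis
    using card_zigzag[of n]
    by (simp add: starts_second card_Un_disjoint card_image inj_on_def)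
qed

section \<open>Narayana's recurrence\<close>

text \<open>The index is shifted: \<open>narayana n\<close> is \<open>s_(n+1) + 1\<close>, with
  initial values 2, 2, 3 instead of the classical 1, 1, 1. The added 1 absorbs the constant term of
  the recurrence for \<open>s\<close>.\<close>

fun narayana :: "nat \<Rightarrow> nat" where
  "narayana 0 = 2"
| "narayana (Suc 0) = 2"
| "narayana (Suc (Suc 0)) = 3"
| "narayana (Suc (Suc (Suc n))) = narayana (Suc (Suc n)) + narayana n"

lemma card_starts_max: "card (starts (Suc n) (Suc n)) + 1 = narayana n"
proof (induction n rule: narayana.induct)
  case 1
  have "starts (Suc 0) (Suc 0) = {[1]}" by (auto simp: starts_def good_1_iff)
  then show ?case by simp
next
  case 2
  have "starts (Suc (Suc 0)) (Suc (Suc 0)) = {[2, 1]}" by (auto simp: starts_def good_2_iff)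
  then show ?case by simp
next
  case 3
  have "starts (Suc (Suc 0)) (Suc (Suc 0)) = {[2, 1]}" "starts (Suc (Suc 0)) (Suc 0) = {[1, 2]}"
    by (auto simp: starts_def good_2_iff)
  then show ?case by (simp add: card_starts_max_Suc[of "Suc 0"])
next
  case (4 n)
  then show ?case by (simp add: card_starts_max_Suc[of "Suc (Suc n)"] card_starts_second)
qed

text \<open>Of the \<open>n + 2\<close> lists ending in the maximum, 2 is cancelled by the two
  shifts by 1 in \<open>card_starts_max\<close>.\<close>

lemma num_A_eq_narayana:
  "num_A (n + 3) = narayana (n + 2) + narayana n + n"
proof -
  let ?N = "Suc (Suc (Suc n))"
  let ?S = "starts ?N ?N"
  let ?I = "(\<lambda>R. Suc (Suc n) # ?N # R) ` starts (Suc n) (Suc n)"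
  let ?E = "ends ?N ?N"
  have "?S \<inter> ?I = {}" by (auto simp: starts_def)
  moreover have "(?S \<union> ?I) \<inter> ?E = {}"
    using good_hd_neq_last[of "Suc n"] good_last_le[of "Suc n"] good_not_Nil[of n]
    by (fastforce simp: starts_def ends_def)
  ultimately have "num_A ?N = card ?S + card ?I + card ?E"
    unfolding num_A_eq_card_good good_Suc_Suc_Suc_eq by (simp add: card_Un_disjoint)
  also have "card ?I = card (starts (Suc n) (Suc n))"
    by (simp add: card_image inj_on_def)
  also have "card ?S + card (starts (Suc n) (Suc n)) + card ?E = narayana (n + 2) + narayana n + n"
    using card_starts_max[of n] card_starts_max[of "Suc (Suc n)"] card_ends_max[of "Suc n"]
    by simp
  finally show ?thesis by (simp add: numeral_3_eq_3)
qed

section \<open>The roots \<open>rho\<close> and \<open>alpha\<close>\<close>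

lemma cubic_strict_mono: "0 \<le> x \<Longrightarrow> x < y \<Longrightarrow> x + x ^ 3 < y + y ^ 3" for x y :: real
  by (simp add: add_strict_mono power_strict_mono)

lemma ex1_cubic_root: "\<exists>!x::real. 0 < x \<and> 1 - x - x ^ 3 = 0"
  and rho_bounds: "2 / 3 \<le> rho" "rho \<le> 7 / 10"
  and rho_cube: "rho ^ 3 = 1 - rho"
proof -
  \<comment> \<open>This bracket gives \<open>10/7 <= alpha <= 3/2\<close>, tight enough for the
    error bound with ratio \<open>6/5\<close> below.\<close>
  have "\<exists>x\<ge>2/3. x \<le> 7/10 \<and> x + x ^ 3 = (1::real)"
    by (rule IVT') (auto simp: field_simps intro!: continuous_intros)
  then obtain r :: real where r: "2/3 \<le> r" "r \<le> 7/10" "r + r ^ 3 = 1" by blast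
  have root: "0 < r \<and> 1 - r - r ^ 3 = 0" using r by linarith
  have uniq: "x = r" if "0 < x \<and> 1 - x - x ^ 3 = 0" for x
  proof (rule ccontr)
    assume "x \<noteq> r"
    then show False
      using cubic_strict_mono[of x r] cubic_strict_mono[of r x] r that by linarith
  qed
  show "\<exists>!x::real. 0 < x \<and> 1 - x - x ^ 3 = 0" using root uniq by blast
  have "rho = r" unfolding rho_def using root uniq by (rule the_equality)
  then show "2 / 3 \<le> rho" "rho \<le> 7 / 10" "rho ^ 3 = 1 - rho" using r by auto
qed

lemma rho_alpha: "rho * alpha = 1"
  using rho_bounds by (simp add: alpha_def)

lemma alpha_bounds: "10 / 7 \<le> alpha" "alpha \<le> 3 / 2"
  using rho_bounds by (simp_all add: alpha_def field_simps)

lemma alpha_cube: "alpha ^ 3 = alpha\<^sup>2 + 1"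
  using rho_alpha rho_cube by algebra

text \<open>Dividing by \<open>x ^ 3\<close> turns the equation into the one defining
  \<open>rho\<close>, satisfied by \<open>inverse x\<close>.\<close>

lemma alpha_unique:
  assumes "1 < x" "x ^ 3 = x\<^sup>2 + 1"
  shows "x = alpha"
proof -
  have "x * inverse x = 1" using assms by simp
  then have "1 - inverse x - inverse x ^ 3 = 0"
    using assms(2) by algebra
  moreover have "0 < inverse x" using assms by simp
  moreover have "1 - rho - rho ^ 3 = 0" "0 < rho" using rho_cube rho_bounds by auto
  ultimately have "inverse x = rho" using ex1_cubic_root by blast
  then show ?thesis by (metis alpha_def inverse_inverse_eq)
qed

section \<open>Asymptotics\<close>

text \<open>The factor is \<open>alpha^2 + (alpha - 1) * alpha + rho\<close>, so
  \<open>const_C * alpha ^ n\<close> solves the same geometric recurrence as \<open>narayana\<close>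
  in \<open>narayana_geometric\<close>.\<close>

lemma const_C_eq: "const_C * (2 * alpha\<^sup>2 - alpha + rho) = 1 + 2 * alpha + 2 * rho"
proof -
  have "0 < 1 + 3 * rho\<^sup>2" by (simp add: add_pos_nonneg)
  then have nz: "(1 - rho)\<^sup>2 * (1 + 3 * rho\<^sup>2) \<noteq> 0"
    using rho_bounds by simp
  then have "const_C * ((1 - rho)\<^sup>2 * (1 + 3 * rho\<^sup>2)) = 2 * rho - 1"
    by (simp add: const_C_def)
  moreover have "(2 * rho - 1) * (2 * alpha\<^sup>2 - alpha + rho) =
      (1 + 2 * alpha + 2 * rho) * ((1 - rho)\<^sup>2 * (1 + 3 * rho\<^sup>2))"
  proof -
    \<comment> \<open>Eliminating \<open>alpha\<close> leaves a polynomial identity modulo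
      \<open>rho ^ 3 + rho - 1\<close>.\<close>
    have "alpha = rho\<^sup>2 + 1" using rho_alpha rho_cube by algebra
    then show ?thesis using rho_cube by algebra
  qed
  ultimately have "(const_C * (2 * alpha\<^sup>2 - alpha + rho)) * ((1 - rho)\<^sup>2 * (1 + 3 * rho\<^sup>2)) =
      (1 + 2 * alpha + 2 * rho) * ((1 - rho)\<^sup>2 * (1 + 3 * rho\<^sup>2))"
    by (metis mult.assoc mult.commute)
  then show ?thesis using nz by (rule mult_right_cancel[THEN iffD1, rotated])
qed

lemma const_C_pos: "0 < const_C"
  using rho_bounds unfolding const_C_def
  by (intro divide_pos_pos mult_pos_pos) (auto intro: add_pos_nonneg)

text \<open>The factorisation \<open>x ^ 3 - x\<^sup>2 - 1 = (x - \<alpha>) (x\<^sup>2 + (\<alpha> - 1) x + \<rho>)\<close> turns the recurrence into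
  a geometric one.\<close>
lemma narayana_geometric:
  "real (narayana (n + 2)) + (alpha - 1) * real (narayana (n + 1)) + rho * real (narayana n) =
     (1 + 2 * alpha + 2 * rho) * alpha ^ n"
proof (induction n)
  case 0
  then show ?case by (simp add: numeral_2_eq_2 algebra_simps)
next
  case (Suc n)
  define a b c where "a = real (narayana n)" and "b = real (narayana (n + 1))"
    and "c = real (narayana (n + 2))"
  have "real (narayana (Suc n + 2)) = c + a" by (simp add: a_def c_def numeral_2_eq_2)
  moreover have "(c + a) + (alpha - 1) * c + rho * b = alpha * (c + (alpha - 1) * b + rho * a)"
    using rho_alpha alpha_cube by algebra
  ultimately show ?case using Suc by (simp add: a_def b_def c_def)
qed

text \<open>The difference satisfies the homogeneous recurrence of the quadratic factor. Its roots
  have modulus \<open>sqrt rho < 1\<close>, but any ratio below \<open>alpha\<close> suffices, and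
  \<open>6/5\<close> needs only the triangle inequality.\<close>

lemma narayana_error_bound:
  obtains M where "\<And>n. \<bar>real (narayana n) - const_C * alpha ^ n\<bar> \<le> M * (6 / 5) ^ n"
proof -
  define w where "w n = real (narayana n) - const_C * alpha ^ n" for n
  have w_rec: "w (Suc (Suc n)) = - (alpha - 1) * w (Suc n) - rho * w n" for n
  proof -
    have "const_C * alpha ^ (n + 2) + (alpha - 1) * (const_C * alpha ^ (n + 1))
        + rho * (const_C * alpha ^ n) = const_C * (2 * alpha\<^sup>2 - alpha + rho) * alpha ^ n"
      by (simp add: algebra_simps power2_eq_square)
    also have "\<dots> = real (narayana (n + 2)) + (alpha - 1) * real (narayana (n + 1))
        + rho * real (narayana n)"
      by (simp only: const_C_eq narayana_geometric)
    finally show ?thesis by (simp add: w_def algebra_simps)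
  qed
  define M where "M = \<bar>w 0\<bar> + \<bar>w 1\<bar>"
  have "\<bar>w n\<bar> \<le> M * (6 / 5) ^ n \<and> \<bar>w (Suc n)\<bar> \<le> M * (6 / 5) ^ Suc n" for n
  proof (induction n)
    case (Suc n)
    have "0 \<le> M * (6 / 5) ^ n" by (simp add: M_def)
    have "\<bar>w (Suc (Suc n))\<bar> \<le> \<bar>(alpha - 1) * w (Suc n)\<bar> + \<bar>rho * w n\<bar>"
      unfolding w_rec by linarith
    also have "\<dots> \<le> (1 / 2) * (M * (6 / 5) ^ Suc n) + (7 / 10) * (M * (6 / 5) ^ n)"
      using Suc alpha_bounds rho_bounds unfolding abs_mult
      by (intro add_mono mult_mono) auto
    \<comment> \<open>Numerically, \<open>(1/2) * (6/5) + 7/10 = 13/10 <= 36/25\<close>.\<close>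
    also have "\<dots> \<le> M * (6 / 5) ^ Suc (Suc n)"
      using \<open>0 \<le> M * (6 / 5) ^ n\<close> by simp
    finally show ?case using Suc by blast
  qed (simp add: M_def)
  then show thesis by (intro that[of M]) (simp add: w_def)
qed

lemma narayana_limit: "(\<lambda>n. real (narayana n) / alpha ^ n) \<longlonglongrightarrow> const_C"
proof -
  obtain M where M: "\<And>n. \<bar>real (narayana n) - const_C * alpha ^ n\<bar> \<le> M * (6 / 5) ^ n"
    using narayana_error_bound by blast
  have a: "0 < alpha" using alpha_bounds by simp
  have "(\<lambda>n. ((6 / 5) / alpha) ^ n) \<longlonglongrightarrow> 0"
    using alpha_bounds by (intro LIMSEQ_realpow_zero) auto
  then have "(\<lambda>n. real (narayana n) / alpha ^ n - const_C) \<longlonglongrightarrow> 0"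
  proof (rule tendsto_0_le[where K = M], intro always_eventually allI)
    fix n
    have "real (narayana n) / alpha ^ n - const_C =
        (real (narayana n) - const_C * alpha ^ n) / alpha ^ n"
      using a by (simp add: diff_divide_distrib)
    then have "norm (real (narayana n) / alpha ^ n - const_C) =
        \<bar>real (narayana n) - const_C * alpha ^ n\<bar> / alpha ^ n"
      using a by (simp add: abs_divide power_abs)
    also have "\<dots> \<le> M * (6 / 5) ^ n / alpha ^ n"
      using M a by (intro divide_right_mono) auto
    finally show "norm (real (narayana n) / alpha ^ n - const_C) \<le> norm (((6 / 5) / alpha) ^ n) * M"
      using a by (simp add: power_divide power_abs ac_simps)
  qed
  then show ?thesis by (simp add: LIM_zero_iff)
qed

lemma num_A_limit: "(\<lambda>n. real (num_A n) / (const_C * alpha ^ n)) \<longlonglongrightarrow> 1"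
proof -
  have a: "1 < alpha" "0 < alpha" using alpha_bounds by simp_all
  have "(\<lambda>n. real n * (1 / alpha) ^ n) \<longlonglongrightarrow> 0"
    using a by (intro powser_times_n_limit_0) simp
  then have "(\<lambda>n. real n / alpha ^ n) \<longlonglongrightarrow> 0"
    by (simp add: power_divide)
  then have "(\<lambda>n. (alpha\<^sup>2 * (real (narayana (n + 2)) / alpha ^ (n + 2))
      + real (narayana n) / alpha ^ n + real n / alpha ^ n) / (const_C * alpha ^ 3))
      \<longlonglongrightarrow> (alpha\<^sup>2 * const_C + const_C + 0) / (const_C * alpha ^ 3)"
    using a const_C_pos
    by (intro tendsto_intros narayana_limit LIMSEQ_ignore_initial_segment[OF narayana_limit]) auto
  \<comment> \<open>The contributions of \<open>narayana (n + 2)\<close> and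
    \<open>narayana n\<close> add up to \<open>alpha^2 + 1\<close>, which is exactly
    \<open>alpha ^ 3\<close>, the factor from the index shift by 3.\<close>
  moreover have "(alpha\<^sup>2 * const_C + const_C + 0) / (const_C * alpha ^ 3) = 1"
  proof -
    have "alpha\<^sup>2 * const_C + const_C + 0 = const_C * alpha ^ 3"
      by (simp add: alpha_cube algebra_simps)
    then show ?thesis using a const_C_pos by simp
  qed
  moreover have "(alpha\<^sup>2 * (real (narayana (n + 2)) / alpha ^ (n + 2))
      + real (narayana n) / alpha ^ n + real n / alpha ^ n) / (const_C * alpha ^ 3) =
      real (num_A (n + 3)) / (const_C * alpha ^ (n + 3))" for n
    unfolding num_A_eq_narayana
    using a const_C_pos by (simp add: power_add power2_eq_square field_simps)
  ultimately have "(\<lambda>n. real (num_A (n + 3)) / (const_C * alpha ^ (n + 3))) \<longlonglongrightarrow> 1"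
    by (simp only:)
  then show ?thesis by (rule LIMSEQ_offset)
qed

theorem mainTheorem8:
  shows "(\<exists>!x::real. 0 < x \<and> 1 - x - x ^ 3 = 0) \<and> rho \<in> {0<..<1} \<and>
    (\<lambda>n. real (num_A n)) \<sim>[at_top] (\<lambda>n. const_C * alpha ^ n) \<and>
    (\<lambda>n. real (num_A n) / (const_C * alpha ^ n)) \<longlonglongrightarrow> 1 \<and>
    (1 < alpha \<and> alpha ^ 3 = alpha\<^sup>2 + 1 \<and>
      (\<forall>x::real. 1 < x \<and> x ^ 3 = x\<^sup>2 + 1 \<longrightarrow> x = alpha))"
proof (intro conjI allI impI)
  show "rho \<in> {0<..<1}" using rho_bounds by simp
  show "1 < alpha" using alpha_bounds by simp
  show "(\<lambda>n. real (num_A n)) \<sim>[at_top] (\<lambda>n. const_C * alpha ^ n)"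
    using num_A_limit by (rule asymp_equivI')
qed (use ex1_cubic_root num_A_limit alpha_cube alpha_unique in auto)

end
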